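(* Let $X^{(l+1)}=AX^{(l)}W^{(l)}$, $l\ge 0$, be a linear GCN, where $A\in\mathbb{R}^{N\times N}$, $X^{(l)}\in\mathbb{R}^{N\times d}$ and $W^{(l)}\in\mathbb{R}^{d\times d}$. Let $\lambda_1,\lambda_2$ be the largest and second-largest eigenvalues (in modulus) of $A$, respectively, and assume $|\lambda_2/\lambda_1|<1$. Assume the weights $\{W^{(l)}\}_{l\ge 0}$ are randomly sampled from i.i.d. random variables with distribution $\nu$ such that $$\int\log^+(\|W\|)\,d\nu+\int\log^+(\|W^{-1}\|)\,d\nu<\infty .$$ Then the following identity holds almost surely: $$\lim_{l\to\infty}\mathrm{NumRank}(X^{(l)})=1 .$$
   Context: $\log^+(t)=\max\{\log t,0\}$ and $\|\cdot\|$ is a matrix norm. The numerical rank of a matrix $X$ is $\mathrm{NumRank}(X)=\|X\|_F^2/\|X\|_2^2$, where $\|\cdot\|_F$ is the Frobenius norm and $\|\cdot\|_2$ the spectral norm. $X^{(0)}$ is the initial (input) feature matrix, whose rows are the feature vectors of the $N$ nodes of a graph, and $A$ is the message-passing matrix of the graph.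
   Formalization: The identity is proved for Lebesgue-almost every initial feature matrix X^(0), almost surely in the weights; for arbitrary X^(0) it fails, e.g. A=diag(2,1), W=diag(1,2), X^(0)=I gives NumRank 2 for all l. *)

theory Defs
  imports "HOL-Probability.Probability" "HOL-Computational_Algebra.Computational_Algebra"
begin

definition charpoly :: "'a::comm_ring_1^'n^'n \<Rightarrow> 'a poly" where
  "charpoly A = det (\<chi> i j. (if i = j then [:0, 1:] else 0) - [:A $ i $ j:])"

(* Complex eigenvalues, each repeated according to its algebraic multiplicity. *)
definition eigenvalues :: "real^'n^'n \<Rightarrow> complex multiset" where
  "eigenvalues A = proots (charpoly (\<chi> i j. complex_of_real (A $ i $ j)))"

(* l1 and l2 are the first two entries of some enumeration of the eigenvalues (with
   multiplicity) by non-increasing modulus. Counting multiplicity is essential: the condition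
   |l2 / l1| < 1 is meant to force l1 to be simple. In particular the dimension is at least 2. *)
definition leading_eigenvalues :: "real^'n^'n \<Rightarrow> complex \<Rightarrow> complex \<Rightarrow> bool" where
  "leading_eigenvalues A l1 l2 \<longleftrightarrow>
     (\<exists>R. eigenvalues A = add_mset l1 (add_mset l2 R) \<and>
          cmod l2 \<le> cmod l1 \<and> (\<forall>\<mu>\<in>#R. cmod \<mu> \<le> cmod l2))"

(* Submultiplicativity is deliberately not required, so that every usual meaning of
   "matrix norm" is covered. *)
definition is_matrix_norm :: "(real^'m^'n \<Rightarrow> real) \<Rightarrow> bool" where
  "is_matrix_norm nrm \<longleftrightarrow>
     (\<forall>X. nrm X = 0 \<longleftrightarrow> X = 0) \<and>
     (\<forall>c X. nrm (c *\<^sub>R X) = \<bar>c\<bar> * nrm X) \<and>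
     (\<forall>X Y. nrm (X + Y) \<le> nrm X + nrm Y)"

(* HOL has ln 0 = 0, so log_plus 0 = 0, in agreement with the convention log 0 = -infinity. *)
definition log_plus :: "real \<Rightarrow> real" where
  "log_plus t = max (ln t) 0"

definition frobenius_norm :: "real^'m^'n \<Rightarrow> real" where
  "frobenius_norm X = sqrt (\<Sum>i\<in>UNIV. \<Sum>j\<in>UNIV. (X $ i $ j)\<^sup>2)"

lemma frobenius_norm_eq_norm: "frobenius_norm X = norm X"
  by (simp add: frobenius_norm_def norm_vec_def L2_set_def sum_nonneg)

definition spectral_norm :: "real^'m^'n \<Rightarrow> real" where
  "spectral_norm X = onorm ((*v) X)"

definition num_rank :: "real^'m^'n \<Rightarrow> real" where
  "num_rank X = (frobenius_norm X)\<^sup>2 / (spectral_norm X)\<^sup>2"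

primrec linear_gcn ::
  "real^'n^'n \<Rightarrow> (nat \<Rightarrow> real^'d^'d) \<Rightarrow> real^'d^'n \<Rightarrow> nat \<Rightarrow> real^'d^'n" where
  "linear_gcn A W X0 0 = X0"
| "linear_gcn A W X0 (Suc l) = A ** linear_gcn A W X0 l ** W l"

(* Degenerate initial features have to be excluded from a statement about the limit of
   num_rank along linear_gcn. For W = 1 any X0 annihilated by the leading left eigenvector
   of A (for instance X0 = 0) may violate it. Being non-orthogonal to that eigenvector is not
   enough either: A = diag(2,1), W = diag(1,2), X0 = 1 gives the iterates 2^l * 1, whose
   numerical rank is 2. The exceptional set depends on the law of the weights, but is
   Lebesgue null; hence "for almost every X0". *)

end

theory Submission imports Defs begin

text \<open>
  The iterates are \<open>A\<^sup>l X\<^sub>0 P\<^sub>l\<close> with \<open>P\<^sub>l = W\<^sub>0 \<cdots> W\<^bsub>l-1\<^esub>\<close>.  Since \<open>l1\<close> is a simple root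
  of the characteristic polynomial and strictly dominates the others, it is real and
  \<open>A\<^sup>l / l1\<^sup>l = g h\<^sup>T + O(r\<^sup>l)\<close> for some \<open>r < 1\<close>.  So, up to scaling, \<open>A\<^sup>l X\<^sub>0 P\<^sub>l\<close> is the rank one matrix
  \<open>g (h\<^sup>T X\<^sub>0 P\<^sub>l)\<close> plus an error \<open>O(r\<^sup>l \<parallel>P\<^sub>l\<parallel>)\<close>, and it suffices that
  \<open>\<parallel>h\<^sup>T X\<^sub>0 P\<^sub>l\<parallel> \<ge> c s\<^sup>l \<parallel>P\<^sub>l\<parallel>\<close> eventually, for some \<open>r < s < 1\<close> and \<open>c > 0\<close>.  For a fixed sequence of invertible weights
  this holds for almost every \<open>X\<^sub>0\<close>: a linear functional of norm 1 is smaller than \<open>s\<^sup>l\<close> only on a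
  slab, whose volume within a ball is \<open>O(s\<^sup>l)\<close>, and Borel--Cantelli applies.  Fubini then exchanges
  the two almost-everywhere quantifiers.\<close>

no_notation fps_nth (infixl "$" 75)

subsection \<open>Simple roots of the characteristic polynomial\<close>

text \<open>Entry \<open>(j, k)\<close> of the adjugate of \<open>M\<close>: a unit vector placed in
  row \<open>k\<close> yields the signed cofactor at full size, without minors.\<close>

definition row_cofactor :: "'a::comm_ring_1^'n^'n \<Rightarrow> 'n \<Rightarrow> 'n \<Rightarrow> 'a" where
  "row_cofactor M k j = det (\<chi> i. if i = k then axis j 1 else M $ i)"

text \<open>Linearity in row \<open>k\<close> collapses the sum to the determinant of
  \<open>M\<close> with row \<open>k\<close> replaced by row \<open>i\<close>, which has two equal
  rows unless \<open>i = k\<close>.\<close>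

lemma row_cofactor_expansion:
  fixes M :: "'a::comm_ring_1^'n^'n"
  shows "(\<Sum>j\<in>UNIV. M $ i $ j * row_cofactor M k j) = (if i = k then det M else 0)"
proof -
  have "(\<Sum>j\<in>UNIV. M $ i $ j * row_cofactor M k j)
      = (\<Sum>j\<in>UNIV. det (\<chi> r. if r = k then M $ i $ j *s axis j 1 else M $ r))"
    unfolding row_cofactor_def using det_row_mul[of k "M $ i $ j" "\<lambda>_. axis j 1" "($) M" for j] by simp
  also have "\<dots> = det (\<chi> r. if r = k then (\<Sum>j\<in>UNIV. M $ i $ j *s axis j 1) else M $ r)"
    by (rule det_linear_row_sum[symmetric]) simp
  also have "(\<Sum>j\<in>UNIV. M $ i $ j *s axis j 1) = M $ i"
    by (simp add: vec_eq_iff axis_def if_distrib sum.delta' cong: if_cong)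
  also have "det (\<chi> r. if r = k then M $ i else M $ r) = (if i = k then det M else 0)"
  proof (cases "i = k")
    case True
    then have "(\<chi> r. if r = k then M $ i else M $ r) = M" by (simp add: vec_eq_iff)
    with True show ?thesis by simp
  next
    case False
    then show ?thesis
      by (simp, intro det_identical_rows[of i k]) (auto simp: row_def vec_eq_iff)
  qed
  finally show ?thesis .
qed

lemma poly_det: "poly (det M) x = det (\<chi> i j. poly (M $ i $ j) x)"
  by (simp add: det_def poly_sum poly_prod)

lemma poly_row_cofactor:
  "poly (row_cofactor M k j) x = row_cofactor (\<chi> i j. poly (M $ i $ j) x) k j"
  unfolding row_cofactor_def poly_det
  by (rule arg_cong[of _ _ det]) (simp add: vec_eq_iff axis_def)

text \<open>Product rule in the Leibniz formula, regrouped by the row whose entry is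
  differentiated.\<close>

lemma pderiv_det:
  fixes M :: "'a::idom poly^'n^'n"
  shows "pderiv (det M) = (\<Sum>k\<in>UNIV. det (\<chi> i. if i = k then (\<chi> j. pderiv (M $ i $ j)) else M $ i))"
proof -
  have pd_sum: "pderiv (\<Sum>x\<in>S. f x) = (\<Sum>x\<in>S. pderiv (f x))" for f :: "('n \<Rightarrow> 'n) \<Rightarrow> 'a poly" and S
    by (induction S rule: infinite_finite_induct) (simp_all add: pderiv_add)
  have pd_sign: "pderiv (of_int z :: 'a poly) = 0" for z
    by (simp add: of_int_poly)
  have "pderiv (det M) =
     (\<Sum>p | p permutes UNIV. \<Sum>k\<in>UNIV. of_int (sign p) * ((\<Prod>i\<in>UNIV-{k}. M $ i $ p i) * pderiv (M $ k $ p k)))"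
    by (simp add: det_def pd_sum pd_sign pderiv_mult pderiv_prod sum_distrib_left sum_distrib_right mult_ac)
  also have "\<dots> = (\<Sum>k\<in>UNIV. \<Sum>p | p permutes UNIV. of_int (sign p) *
      (\<Prod>i\<in>UNIV. (\<chi> i. if i = k then (\<chi> j. pderiv (M $ i $ j)) else M $ i) $ i $ p i))"
  proof (subst sum.swap, intro sum.cong refl)
    fix k :: 'n and p :: "'n \<Rightarrow> 'n"
    have "(\<Prod>i\<in>UNIV. (\<chi> i. if i = k then (\<chi> j. pderiv (M $ i $ j)) else M $ i) $ i $ p i)
      = pderiv (M $ k $ p k) * (\<Prod>i\<in>UNIV-{k}. M $ i $ p i)"
      by (subst prod.remove[of _ k]) (auto intro!: prod.cong)
    then show "of_int (sign p) * ((\<Prod>i\<in>UNIV-{k}. M $ i $ p i) * pderiv (M $ k $ p k))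
      = of_int (sign p) * (\<Prod>i\<in>UNIV. (\<chi> i. if i = k then (\<chi> j. pderiv (M $ i $ j)) else M $ i) $ i $ p i)"
      by (simp add: mult_ac)
  qed
  finally show ?thesis by (simp add: det_def)
qed

definition char_mat :: "'a::comm_ring_1^'n^'n \<Rightarrow> 'a poly^'n^'n" where
  "char_mat A = (\<chi> i j. (if i = j then [:0, 1:] else 0) - [:A $ i $ j:])"

lemma charpoly_eq_det_char_mat: "charpoly A = det (char_mat A)"
  by (simp add: charpoly_def char_mat_def)

lemma char_mat_eval: "(\<chi> i j. poly (char_mat A $ i $ j) x) = mat x - A"
  by (simp add: vec_eq_iff char_mat_def mat_def)

text \<open>Differentiating row \<open>k\<close> of the characteristic matrix leaves a unit vector,
  so the row formula becomes the trace of the adjugate.\<close>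

lemma pderiv_charpoly:
  fixes A :: "'a::idom^'n^'n"
  shows "pderiv (charpoly A) = (\<Sum>k\<in>UNIV. row_cofactor (char_mat A) k k)"
  unfolding charpoly_eq_det_char_mat pderiv_det row_cofactor_def
proof (intro sum.cong refl arg_cong[of _ _ det])
  fix k :: 'n
  have "(\<chi> j. pderiv (char_mat A $ k $ j)) = axis k 1"
    by (auto simp: vec_eq_iff char_mat_def axis_def pderiv_diff pderiv_pCons)
  then show "(\<chi> i. if i = k then \<chi> j. pderiv (char_mat A $ i $ j) else char_mat A $ i) =
         (\<chi> i. if i = k then axis k 1 else char_mat A $ i)"
    by (simp add: vec_eq_iff)
qed

text \<open>At a simple root the trace of the adjugate of \<open>mat x - A\<close> is nonzero, hence
  so is some principal cofactor; its index is \<open>k\<close>, and the adjugate column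
  \<open>k\<close> is \<open>u\<close>. A solution \<open>c\<close> with \<open>c $ k = 0\<close>
  does not see row \<open>k\<close>, so it is also annihilated by the matrix with that row replaced
  by a unit vector, whose determinant is the nonzero cofactor.\<close>

lemma simple_eigenvalue:
  fixes A :: "'a::field^'n^'n"
  assumes root: "poly (charpoly A) x = 0" and simple: "poly (pderiv (charpoly A)) x \<noteq> 0"
  obtains k and u :: "'a^'n" where "A *v u = x *s u" "u $ k \<noteq> 0"
    "\<And>c. c v* A = x *s c \<Longrightarrow> c $ k = 0 \<Longrightarrow> c = 0"
proof -
  let ?B = "mat x - A"
  have det0: "det ?B = 0"
    using root by (simp add: charpoly_eq_det_char_mat poly_det char_mat_eval)
  have "(\<Sum>k\<in>UNIV. row_cofactor ?B k k) \<noteq> 0"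
    using simple by (simp add: pderiv_charpoly poly_sum poly_row_cofactor char_mat_eval)
  then obtain k where k: "row_cofactor ?B k k \<noteq> 0"
    by (meson sum.neutral)
  define u where "u = (\<chi> j. row_cofactor ?B k j)"
  have "?B *v u = 0"
    using row_cofactor_expansion[of ?B _ k] det0
    by (simp add: vec_eq_iff matrix_vector_mult_def u_def)
  then have "A *v u = x *s u"
    by (simp add: vec_eq_iff matrix_vector_mult_def mat_def algebra_simps sum_subtractf
        if_distrib[of "\<lambda>t. _ * t"] sum.delta cong: if_cong)
  moreover have "c = 0" if c: "c v* A = x *s c" "c $ k = 0" for c :: "'a^'n"
  proof -
    let ?N = "\<chi> i. if i = k then axis k 1 else ?B $ i"
    have "c v* ?B = 0"
      using c(1) by (simp add: vec_eq_iff vector_matrix_mult_def mat_def algebra_simps sum_subtractf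
        if_distrib[of "\<lambda>t. _ * t"] sum.delta' cong: if_cong)
    moreover have "c v* ?N = c v* ?B"
      unfolding vec_eq_iff vector_matrix_mult_def using c(2) by (auto intro!: sum.cong)
    ultimately have "transpose ?N *v c = 0" by simp
    moreover have "invertible (transpose ?N)"
      using k by (simp add: invertible_det_nz row_cofactor_def)
    ultimately show ?thesis
      by (metis invertible_def matrix_left_invertible_ker)
  qed
  ultimately show thesis using that k by (simp add: u_def)
qed

subsection \<open>Linear recurrences and the dominant eigenvalue\<close>

text \<open>The operator \<open>p(S)\<close>, where \<open>S\<close> is the left shift on sequences.
  Factoring \<open>p\<close> turns a linear recurrence into successive first-order ones.\<close>

definition shift_op :: "'a::comm_ring_1 poly \<Rightarrow> (nat \<Rightarrow> 'a) \<Rightarrow> nat \<Rightarrow> 'a" where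
  "shift_op p s l = (\<Sum>i\<le>degree p. coeff p i * s (l + i))"

lemma shift_op_bound: "degree p \<le> n \<Longrightarrow> shift_op p s l = (\<Sum>i\<le>n. coeff p i * s (l + i))"
  unfolding shift_op_def by (rule sum.mono_neutral_left) (auto simp: coeff_eq_0)

lemma shift_op_0 [simp]: "shift_op 0 s = (\<lambda>l. 0)"
  by (simp add: shift_op_def fun_eq_iff)

lemma shift_op_pCons: "shift_op (pCons a p) s = (\<lambda>l. a * s l + shift_op p s (Suc l))"
proof
  fix l
  have "shift_op (pCons a p) s l = (\<Sum>i\<le>Suc (degree p). coeff (pCons a p) i * s (l + i))"
    by (rule shift_op_bound) (simp add: degree_pCons_le)
  also have "\<dots> = a * s l + shift_op p s (Suc l)"
    by (simp add: sum.atMost_Suc_shift shift_op_def del: sum.atMost_Suc)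
  finally show "shift_op (pCons a p) s l = a * s l + shift_op p s (Suc l)" .
qed

lemma shift_op_add: "shift_op (p + q) s = (\<lambda>l. shift_op p s l + shift_op q s l)"
proof
  fix l
  let ?n = "max (degree p) (degree q)"
  show "shift_op (p + q) s l = shift_op p s l + shift_op q s l"
    using shift_op_bound[of "p + q" ?n s l] shift_op_bound[of p ?n s l] shift_op_bound[of q ?n s l]
    by (simp add: degree_add_le_max sum.distrib algebra_simps)
qed

lemma shift_op_smult: "shift_op (smult a p) s = (\<lambda>l. a * shift_op p s l)"
  using shift_op_bound[of "smult a p" "degree p" s]
  by (simp add: fun_eq_iff shift_op_def sum_distrib_left mult_ac degree_smult_le)

lemma shift_op_mult: "shift_op (p * q) s = shift_op p (shift_op q s)"
  by (induction p) (simp_all add: shift_op_pCons shift_op_add shift_op_smult)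

lemma shift_op_sum_poly: "shift_op (\<Sum>x\<in>S. p x) s = (\<lambda>l. \<Sum>x\<in>S. shift_op (p x) s l)"
  by (induction S rule: infinite_finite_induct) (simp_all add: shift_op_add)

lemma shift_op_sum: "shift_op p (\<lambda>l. \<Sum>x\<in>S. s x l) = (\<lambda>l. \<Sum>x\<in>S. shift_op p (s x) l)"
  unfolding fun_eq_iff shift_op_def
  by (auto simp: sum_distrib_left intro: sum.swap)

lemma shift_op_diff: "shift_op p (\<lambda>l. s l - t l) = (\<lambda>l. shift_op p s l - shift_op p t l)"
  by (simp add: fun_eq_iff shift_op_def sum_subtractf algebra_simps)

lemma shift_op_zero_seq [simp]: "shift_op p (\<lambda>_. 0) = (\<lambda>_. 0)"
  by (simp add: fun_eq_iff shift_op_def)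

lemma shift_op_geometric: "shift_op p (\<lambda>l. c * x ^ l) = (\<lambda>l. poly p x * c * x ^ l)"
  by (simp add: fun_eq_iff shift_op_def poly_altdef sum_distrib_right sum_distrib_left power_add mult_ac)

text \<open>Cayley--Hamilton for sequences: the entries of \<^term>\<open>s\<close> satisfy a linear system whose
  coefficients are polynomials in the shift, so multiplying by the adjugate decouples it.\<close>

lemma shift_op_charpoly:
  fixes A :: "'a::comm_ring_1^'n^'n"
  assumes rec: "\<And>l. s (Suc l) = s l v* A"
  shows "shift_op (charpoly A) (\<lambda>l. s l $ k) = (\<lambda>_. 0)"
proof -
  let ?M = "char_mat A" and ?s = "\<lambda>i l. s l $ i"
  have system: "(\<lambda>l. \<Sum>i\<in>UNIV. shift_op (?M $ i $ j) (?s i) l) = (\<lambda>_. 0)" for j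
  proof
    fix l
    have "shift_op (?M $ i $ j) (?s i) l = (if i = j then s (Suc l) $ i else 0) - A $ i $ j * s l $ i" for i
      by (simp add: char_mat_def shift_op_pCons)
    then show "(\<Sum>i\<in>UNIV. shift_op (?M $ i $ j) (?s i) l) = 0"
      by (simp add: sum_subtractf sum.delta rec vector_matrix_mult_def mult.commute)
  qed
  have "shift_op (charpoly A) (?s k) = (\<lambda>l. \<Sum>i\<in>UNIV. shift_op (if i = k then det ?M else 0) (?s i) l)"
    by (simp add: charpoly_eq_det_char_mat fun_eq_iff if_distrib[of "\<lambda>p. shift_op p _ _"] sum.delta cong: if_cong)
  also have "\<dots> = (\<lambda>l. \<Sum>i\<in>UNIV. \<Sum>j\<in>UNIV. shift_op (row_cofactor ?M k j * ?M $ i $ j) (?s i) l)"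
    by (simp add: row_cofactor_expansion[symmetric] shift_op_sum_poly mult.commute)
  also have "\<dots> = (\<lambda>l. \<Sum>j\<in>UNIV. shift_op (row_cofactor ?M k j) (\<lambda>l. \<Sum>i\<in>UNIV. shift_op (?M $ i $ j) (?s i) l) l)"
    by (subst sum.swap) (simp add: shift_op_mult shift_op_sum)
  also have "\<dots> = (\<lambda>_. 0)" by (simp add: system)
  finally show ?thesis .
qed

text \<open>Induction over the roots: undoing one factor means solving
  \<open>s (Suc l) = \<mu> * s l + t l\<close>. Since \<open>cmod \<mu> < r\<close> is strict, the
  bound \<open>O(r^l)\<close> survives without polynomial factors, whatever the
  multiplicities.\<close>

lemma shift_op_growth:
  fixes s :: "nat \<Rightarrow> complex"
  assumes "\<And>\<mu>. \<mu> \<in># R \<Longrightarrow> cmod \<mu> < r" and "0 < r"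
    and "\<And>l. cmod (shift_op (\<Prod>\<mu>\<in>#R. [:-\<mu>, 1:]) s l) \<le> C * r ^ l"
  shows "\<exists>D. \<forall>l. cmod (s l) \<le> D * r ^ l"
  using assms(1,3)
proof (induction R arbitrary: s C)
  case empty
  then show ?case by (auto simp: shift_op_def)
next
  case (add \<mu> R)
  define t where "t = shift_op [:-\<mu>, 1:] s"
  have eq: "(\<Prod>\<mu>\<in>#add_mset \<mu> R. [:-\<mu>, 1:]) = (\<Prod>\<mu>\<in>#R. [:-\<mu>, 1:]) * [:-\<mu>, 1:]"
    by (simp add: mult.commute)
  have "\<exists>D. \<forall>l. cmod (t l) \<le> D * r ^ l"
  proof (rule add.IH)
    show "cmod (shift_op (\<Prod>\<mu>\<in>#R. [:-\<mu>, 1:]) t l) \<le> C * r ^ l" for l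
      using add.prems(2)[of l] unfolding eq shift_op_mult t_def .
  qed (use add.prems in auto)
  then obtain D where D: "\<And>l. cmod (t l) \<le> D * r ^ l" by blast
  have "0 \<le> D" using D[of 0] norm_ge_zero[of "t 0"] by (auto simp del: norm_ge_zero)
  have mu: "cmod \<mu> < r" using add.prems by simp
  \<comment> \<open>\<open>E\<close> dominates \<open>cmod (s 0)\<close> for the base case and
    satisfies \<open>(r - cmod \<mu>) * E >= D\<close> for the induction step.\<close>
  define E where "E = cmod (s 0) + D / (r - cmod \<mu>)"
  have E: "0 \<le> E" "cmod \<mu> * E + D \<le> r * E"
  proof -
    show "0 \<le> E" using \<open>0 \<le> D\<close> mu by (simp add: E_def)
    have "D = (r - cmod \<mu>) * (D / (r - cmod \<mu>))" using mu by simp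
    also have "\<dots> \<le> (r - cmod \<mu>) * E" using mu by (intro mult_left_mono) (auto simp: E_def)
    finally show "cmod \<mu> * E + D \<le> r * E" by (simp add: algebra_simps)
  qed
  have "cmod (s l) \<le> E * r ^ l" for l
  proof (induction l)
    case 0
    show ?case using \<open>0 \<le> D\<close> mu by (simp add: E_def)
  next
    case (Suc l)
    have "s (Suc l) = \<mu> * s l + t l" by (simp add: t_def shift_op_pCons)
    then have "cmod (s (Suc l)) \<le> cmod \<mu> * cmod (s l) + cmod (t l)"
      by (metis norm_mult norm_triangle_ineq)
    also have "\<dots> \<le> cmod \<mu> * (E * r ^ l) + D * r ^ l"
      using Suc D by (intro add_mono mult_left_mono) auto
    also have "\<dots> = (cmod \<mu> * E + D) * r ^ l" by (simp add: algebra_simps)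
    also have "\<dots> \<le> (r * E) * r ^ l" using E \<open>0 < r\<close> by (intro mult_right_mono) auto
    finally show ?case by (simp add: mult_ac)
  qed
  then show ?case by blast
qed

text \<open>Applying the factor of \<open>p\<close> with the small roots to \<open>s\<close> leaves
  a sequence annihilated by \<open>S - x\<close>, hence geometric. Subtracting from \<open>s\<close>
  a multiple of \<open>x ^ l\<close> with the same image leaves a sequence annihilated by that
  factor, which is \<open>O(r^l)\<close>.\<close>

lemma dominant_root_asymptotics:
  fixes s :: "nat \<Rightarrow> complex"
  assumes p: "p = smult a ([:-x, 1:] * (\<Prod>\<mu>\<in>#R. [:-\<mu>, 1:]))" and "a \<noteq> 0"
    and R: "\<And>\<mu>. \<mu> \<in># R \<Longrightarrow> cmod \<mu> < r" and r: "0 < r" "r < cmod x"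
    and s: "shift_op p s = (\<lambda>_. 0)"
  shows "\<exists>c D. \<forall>l. cmod (s l - c * x ^ l) \<le> D * r ^ l"
proof -
  let ?q = "\<Prod>\<mu>\<in>#R. [:-\<mu>, 1:]"
  define t where "t = shift_op ?q s"
  have "poly ?q x \<noteq> 0"
    using R[of x] r by (auto simp: poly_prod_mset prod_mset_zero_iff)
  have "shift_op [:-x, 1:] t = (\<lambda>_. 0)"
    using s \<open>a \<noteq> 0\<close> unfolding p shift_op_smult shift_op_mult t_def by (simp add: fun_eq_iff)
  then have step: "t (Suc l) = x * t l" for l
    by (simp add: shift_op_pCons fun_eq_iff)
  have "t l = t 0 * x ^ l" for l
    by (induction l) (simp_all add: step)
  then have t: "t = (\<lambda>l. t 0 * x ^ l)" by blast
  \<comment> \<open>The operator of \<open>?q\<close> multiplies the sequence \<open>x ^ l\<close>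
    by \<open>poly ?q x\<close>, which is nonzero because \<open>x\<close> exceeds all roots of
    \<open>?q\<close> in modulus.\<close>
  define c where "c = t 0 / poly ?q x"
  have "shift_op ?q (\<lambda>l. s l - c * x ^ l) = (\<lambda>l. 0)"
    unfolding shift_op_diff shift_op_geometric t_def[symmetric]
    by (subst t) (use \<open>poly ?q x \<noteq> 0\<close> in \<open>simp add: c_def\<close>)
  then have "\<exists>D. \<forall>l. cmod (s l - c * x ^ l) \<le> D * r ^ l"
    by (intro shift_op_growth[where C = 0, OF R r(1)]) auto
  then show ?thesis by blast
qed

section \<open>Powers of a matrix with a simple dominant eigenvalue\<close>

primrec mat_power :: "'a::semiring_1^'n^'n \<Rightarrow> nat \<Rightarrow> 'a^'n^'n" where
  "mat_power A 0 = mat 1"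
| "mat_power A (Suc l) = mat_power A l ** A"

lemma mat_power_commute: "A ** mat_power A l = mat_power A l ** A"
  by (induction l) (simp_all add: matrix_mul_assoc)

text \<open>Each entry of \<open>mat_power A l\<close> obeys the recurrence of the characteristic
  polynomial, so divided by \<open>l1 ^ l\<close> it converges geometrically. The rows of the limit
  lie in the one-dimensional left eigenspace, so its rank is at most one; it fixes a right
  eigenvector, so it is nonzero.\<close>

lemma dominant_eigenvalue_rank_one:
  fixes A :: "real^'n^'n"
  assumes eig: "leading_eigenvalues A l1 l2" and "l1 \<noteq> 0" and gap: "cmod (l2 / l1) < 1"
  obtains x r D :: real and g h :: "real^'n"
  where "x \<noteq> 0" "0 < r" "r < 1" "g \<noteq> 0" "h \<noteq> 0"
    "\<And>l i j. \<bar>mat_power A l $ i $ j / x ^ l - g $ i * h $ j\<bar> \<le> D * r ^ l"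
proof -
  define B :: "complex^'n^'n" where "B = (\<chi> i j. of_real (A $ i $ j))"
  define p where "p = charpoly B"
  obtain R where R: "proots p = add_mset l1 (add_mset l2 R)" "\<And>\<mu>. \<mu> \<in># R \<Longrightarrow> cmod \<mu> \<le> cmod l2"
    using eig unfolding leading_eigenvalues_def eigenvalues_def p_def B_def by blast
  have "p \<noteq> 0" using R by auto
  let ?q = "\<Prod>\<mu>\<in>#add_mset l2 R. [:-\<mu>, 1:]"
  have p: "p = smult (lead_coeff p) ([:-l1, 1:] * ?q)"
    using complex_poly_decompose_multiset[of p] by (simp add: R(1))
  have l2l1: "cmod l2 < cmod l1" using gap \<open>l1 \<noteq> 0\<close> by (simp add: norm_divide divide_simps)
  \<comment> \<open>A radius strictly between \<open>cmod l2\<close> and \<open>cmod l1\<close>; the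
    room above \<open>cmod l2\<close> absorbs polynomial factors from repeated eigenvalues.\<close>
  define r0 where "r0 = (cmod l1 + cmod l2) / 2"
  have r0: "0 < r0" "r0 < cmod l1" "cmod l2 < r0"
    using l2l1 \<open>l1 \<noteq> 0\<close> norm_ge_zero[of l2] unfolding r0_def by (auto simp del: norm_ge_zero)
  have small: "cmod \<mu> < r0" if "\<mu> \<in># add_mset l2 R" for \<mu>
    using that R(2) r0(3) by fastforce
  \<comment> \<open>The cofactor of the root \<open>l1\<close> does not vanish at \<open>l1\<close>,
    so the root is simple.\<close>
  have "poly ?q l1 \<noteq> 0"
    using small[of l1] r0 by (auto simp: poly_prod_mset prod_mset_zero_iff)
  moreover have "poly (pderiv (smult b ([:-l1, 1:] * q))) l1 = b * poly q l1" for b and q :: "complex poly"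
    unfolding pderiv_smult pderiv_mult by (simp add: pderiv_pCons)
  ultimately have "poly (pderiv p) l1 \<noteq> 0"
    using \<open>p \<noteq> 0\<close> by (metis p leading_coeff_0_iff mult_eq_0_iff)
  moreover have "poly p l1 = 0" by (subst p) simp
  ultimately obtain k and u :: "complex^'n" where u: "B *v u = l1 *s u" "u $ k \<noteq> 0"
    and uniq: "\<And>c. c v* B = l1 *s c \<Longrightarrow> c $ k = 0 \<Longrightarrow> c = 0"
    using simple_eigenvalue[of B l1] unfolding p_def by metis
  define a where "a = (\<lambda>i j l. complex_of_real (mat_power A l $ i $ j))"
  have rec: "a i j (Suc l) = (\<Sum>m\<in>UNIV. B $ m $ j * a i m l)" for i j l
    by (simp add: a_def B_def matrix_matrix_mult_def mult.commute)
  have "\<exists>c D. \<forall>l. cmod (a i j l - c * l1 ^ l) \<le> D * r0 ^ l" for i j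
  proof (rule dominant_root_asymptotics[OF p _ small r0(1,2)])
    show "shift_op p (a i j) = (\<lambda>_. 0)"
      using shift_op_charpoly[of "\<lambda>l. \<chi> j. a i j l" B j]
      by (simp add: rec vec_eq_iff vector_matrix_mult_def p_def mult.commute)
  qed (use \<open>p \<noteq> 0\<close> in auto)
  then obtain c D0 where cD: "\<And>i j l. cmod (a i j l - c i j * l1 ^ l) \<le> D0 i j * r0 ^ l"
    by metis
  define r where "r = r0 / cmod l1"
  have r: "0 < r" "r < 1" using r0 by (auto simp: r_def divide_simps)
  define D where "D = (\<Sum>i\<in>UNIV. \<Sum>j\<in>UNIV. \<bar>D0 i j\<bar>)"
  have "\<bar>D0 i j\<bar> \<le> D" for i j
  proof -
    have "\<bar>D0 i j\<bar> \<le> (\<Sum>j\<in>UNIV. \<bar>D0 i j\<bar>)" by (rule member_le_sum) auto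
    also have "\<dots> \<le> D" unfolding D_def by (rule member_le_sum[where f = "\<lambda>i. \<Sum>j\<in>UNIV. \<bar>D0 i j\<bar>"]) (auto intro: sum_nonneg)
    finally show ?thesis .
  qed
  then have D: "D0 i j \<le> D" for i j by (meson abs_le_D1)
  have close: "cmod (a i j l / l1 ^ l - c i j) \<le> D * r ^ l" for i j l
  proof -
    have "cmod (a i j l / l1 ^ l - c i j) = cmod (a i j l - c i j * l1 ^ l) / cmod l1 ^ l"
      using \<open>l1 \<noteq> 0\<close> by (simp add: norm_divide[symmetric] norm_power[symmetric] divide_simps)
    also have "\<dots> \<le> D * r0 ^ l / cmod l1 ^ l"
      using order_trans[OF cD mult_right_mono[OF D]] r0(1) by (intro divide_right_mono) auto
    finally show ?thesis by (simp add: r_def power_divide)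
  qed
  have lim: "(\<lambda>l. a i j l / l1 ^ l) \<longlonglongrightarrow> c i j" for i j
  proof (rule LIM_zero_cancel, rule Lim_null_comparison)
    show "\<forall>\<^sub>F l in sequentially. cmod (a i j l / l1 ^ l - c i j) \<le> D * r ^ l"
      using close by simp
    show "(\<lambda>l. D * r ^ l) \<longlonglongrightarrow> 0"
      using tendsto_mult_right_zero[OF LIMSEQ_realpow_zero[of r]] r by auto
  qed
  \<comment> \<open>Passing to the limit in \<open>mat_power A (Suc l) = mat_power A l ** A\<close>
    makes each row of \<open>c\<close> a solution of the left eigenvalue equation.\<close>
  have left: "(\<chi> j. c i j) v* B = l1 *s (\<chi> j. c i j)" for i
  proof -
    have "(\<Sum>m\<in>UNIV. B $ m $ j * c i m) = l1 * c i j" for j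
    proof (rule LIMSEQ_unique)
      show "(\<lambda>l. \<Sum>m\<in>UNIV. B $ m $ j * (a i m l / l1 ^ l)) \<longlonglongrightarrow> (\<Sum>m\<in>UNIV. B $ m $ j * c i m)"
        by (intro tendsto_intros lim)
      have "(\<Sum>m\<in>UNIV. B $ m $ j * (a i m l / l1 ^ l)) = l1 * (a i j (Suc l) / l1 ^ Suc l)" for l
        using \<open>l1 \<noteq> 0\<close> by (simp add: rec sum_divide_distrib sum_distrib_left)
      then show "(\<lambda>l. \<Sum>m\<in>UNIV. B $ m $ j * (a i m l / l1 ^ l)) \<longlonglongrightarrow> l1 * c i j"
        by (simp only:) (intro tendsto_intros LIMSEQ_Suc[OF lim])
    qed
    then show ?thesis by (simp add: vec_eq_iff vector_matrix_mult_def mult.commute)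
  qed
  \<comment> \<open>The scaled powers fix \<open>u\<close>, hence so does \<open>c\<close>. As
    \<open>u $ k\<close> is nonzero, row \<open>k\<close> of \<open>c\<close> is nonzero, and then
    \<open>uniq\<close> forces \<open>c k k\<close> to be nonzero.\<close>
  have "(\<Sum>j\<in>UNIV. a i j l * u $ j) = l1 ^ l * u $ i" for i l
  proof (induction l)
    case 0
    show ?case
      by (simp add: a_def mat_def if_distrib[of complex_of_real] if_distrib[of "\<lambda>t. t * _"] cong: if_cong)
  next
    case (Suc l)
    have "(\<Sum>j\<in>UNIV. a i j (Suc l) * u $ j) = (\<Sum>m\<in>UNIV. a i m l * (B *v u) $ m)"
      unfolding rec sum_distrib_right matrix_vector_mult_def
      by (subst sum.swap) (simp add: sum_distrib_left mult_ac)
    also have "\<dots> = l1 * (\<Sum>m\<in>UNIV. a i m l * u $ m)"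
      by (simp add: u sum_distrib_left mult_ac)
    also have "\<dots> = l1 ^ Suc l * u $ i" by (simp add: Suc)
    finally show ?case .
  qed
  then have au: "(\<Sum>j\<in>UNIV. a i j l / l1 ^ l * u $ j) = u $ i" for i l
    using \<open>l1 \<noteq> 0\<close> by (simp add: sum_divide_distrib[symmetric])
  have au_lim: "(\<lambda>l. \<Sum>j\<in>UNIV. a i j l / l1 ^ l * u $ j) \<longlonglongrightarrow> (\<Sum>j\<in>UNIV. c i j * u $ j)" for i
    by (intro tendsto_intros lim)
  have cu: "(\<Sum>j\<in>UNIV. c i j * u $ j) = u $ i" for i
    using au_lim[of i] unfolding au LIMSEQ_const_iff by simp
  obtain j0 where "c k j0 \<noteq> 0"
    using cu[of k] u(2) by (metis (no_types, lifting) mult_eq_0_iff sum.neutral)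
  then have ckk: "c k k \<noteq> 0"
    using uniq[OF left[of k]] by (auto simp: vec_eq_iff)
  \<comment> \<open>This combination of rows \<open>i\<close> and \<open>k\<close> solves the left
    eigenvalue equation and vanishes at coordinate \<open>k\<close>, so it is zero.\<close>
  have rank1: "c k k * c i j = c i k * c k j" for i j
  proof -
    let ?d = "\<chi> j. c k k * c i j - c i k * c k j"
    have "?d v* B = c k k *s ((\<chi> j. c i j) v* B) - c i k *s ((\<chi> j. c k j) v* B)"
      by (simp add: vec_eq_iff vector_matrix_mult_def sum_distrib_left sum_subtractf algebra_simps)
    also have "\<dots> = l1 *s ?d" unfolding left by (simp add: vec_eq_iff algebra_simps)
    finally have "?d = 0" using uniq[of ?d] by simp
    then have "?d $ j = 0" by (simp only: zero_index)
    then show ?thesis by simp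
  qed
  \<comment> \<open>\<open>l1\<close> is the limit of ratios of consecutive real diagonal entries. A
    zero denominator is harmless, since the quotient is then 0 and still real.\<close>
  have "Im l1 = 0"
  proof -
    have "(\<lambda>l. l1 * ((a k k (Suc l) / l1 ^ Suc l) / (a k k l / l1 ^ l))) \<longlonglongrightarrow> l1 * (c k k / c k k)"
      by (intro tendsto_intros lim LIMSEQ_Suc[OF lim] ckk)
    moreover have "l1 * ((a k k (Suc l) / l1 ^ Suc l) / (a k k l / l1 ^ l)) = a k k (Suc l) / a k k l" for l
      using \<open>l1 \<noteq> 0\<close> by simp
    ultimately have "(\<lambda>l. a k k (Suc l) / a k k l) \<longlonglongrightarrow> l1"
      using ckk by (simp del: power_Suc)
    then have "(\<lambda>l. Im (a k k (Suc l) / a k k l)) \<longlonglongrightarrow> Im l1"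
      by (rule tendsto_Im)
    moreover have "Im (a k k (Suc l) / a k k l) = 0" for l
      unfolding a_def of_real_divide[symmetric] by (rule Im_complex_of_real)
    ultimately show ?thesis by (simp add: LIMSEQ_const_iff)
  qed
  then have l1: "l1 = of_real (Re l1)" by (simp add: complex_eq_iff)
  define x where "x = Re l1"
  have quot: "a i j l / l1 ^ l = of_real (mat_power A l $ i $ j / x ^ l)" for i j l
    by (subst l1) (simp add: a_def x_def)
  have real: "c i j = of_real (Re (c i j))" for i j
  proof -
    have "(\<lambda>l. Im (a i j l / l1 ^ l)) \<longlonglongrightarrow> Im (c i j)"
      by (rule tendsto_Im[OF lim])
    then show ?thesis unfolding quot by (simp add: LIMSEQ_const_iff complex_eq_iff)
  qed
  \<comment> \<open>Column \<open>k\<close> of the limit, normalised so that its product with row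
    \<open>k\<close> reproduces \<open>c\<close> through \<open>rank1\<close>.\<close>
  define g where "g = (\<chi> i. Re (c i k) / Re (c k k))"
  define h where "h = (\<chi> j. Re (c k j))"
  have ckk': "Re (c k k) \<noteq> 0" using ckk real[of k k] by auto
  have gh: "c i j = of_real (g $ i * h $ j)" for i j
  proof -
    have "Re (c k k * c i j) = Re (c i k * c k j)" by (simp only: rank1)
    then have "Re (c k k) * Re (c i j) = Re (c i k) * Re (c k j)"
      by (subst (asm) (1 2 3 4) real) simp
    then have "Re (c i j) = g $ i * h $ j"
      using ckk' by (simp add: g_def h_def divide_simps mult.commute)
    then show ?thesis by (subst real) simp
  qed
  show thesis
  proof (rule that)
    show "x \<noteq> 0" using \<open>l1 \<noteq> 0\<close> l1 by (auto simp: x_def)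
    show "0 < r" "r < 1" by fact+
    have "g $ k \<noteq> 0" "h $ k \<noteq> 0" using ckk' by (simp_all add: g_def h_def)
    then show "g \<noteq> 0" "h \<noteq> 0" by auto
    show "\<bar>mat_power A l $ i $ j / x ^ l - g $ i * h $ j\<bar> \<le> D * r ^ l" for l i j
      using close[of i j l] unfolding quot gh of_real_diff[symmetric] norm_of_real .
  qed
qed

subsection \<open>The volume of slabs\<close>

lemma lborel_emeasure_translate:
  fixes S :: "'a::euclidean_space set"
  assumes "S \<in> sets lborel"
  shows "(+) c ` S \<in> sets lborel" "emeasure lborel ((+) c ` S) = emeasure lborel S"
proof -
  have eq: "(+) c ` S = (+) (- c) -` S \<inter> space lborel"
  proof (intro set_eqI iffI)
    fix x assume "x \<in> (+) (- c) -` S \<inter> space lborel"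
    then show "x \<in> (+) c ` S" by (intro image_eqI[of _ _ "- c + x"]) auto
  qed auto
  have m: "(+) (- c) \<in> borel_measurable lborel" by simp
  show "(+) c ` S \<in> sets lborel"
    unfolding eq by (rule measurable_sets[OF m]) (use assms in simp)
  have "emeasure lborel S = emeasure (distr lborel borel ((+) (- c))) S"
    by (subst lborel_distr_plus) simp
  also have "\<dots> = emeasure lborel ((+) c ` S)"
    unfolding eq using assms by (subst emeasure_distr) auto
  finally show "emeasure lborel ((+) c ` S) = emeasure lborel S" ..
qed

lemma slab_sets: "{x \<in> ball 0 R. \<bar>a \<bullet> x\<bar> < e} \<in> sets lborel"
  for a :: "'a::euclidean_space"
proof -
  have "open (ball 0 R \<inter> {x. \<bar>a \<bullet> x\<bar> < e})"
    by (intro open_Int open_ball open_Collect_less continuous_intros)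
  moreover have "ball 0 R \<inter> {x. \<bar>a \<bullet> x\<bar> < e} = {x \<in> ball 0 R. \<bar>a \<bullet> x\<bar> < e}" by blast
  ultimately show ?thesis by simp
qed

text \<open>Translating the slab by the multiples \<open>2 k e\<close> of its unit normal, \<open>k \<le> R / (2 e)\<close>, gives
  disjoint sets of the same volume inside the ball of radius \<open>2 R\<close>.\<close>

lemma measure_slab_le:
  fixes a :: "'a::euclidean_space"
  assumes a: "norm a = 1" and e: "0 < e" and R: "0 < R"
  shows "measure lborel {x \<in> ball 0 R. \<bar>a \<bullet> x\<bar> < e} \<le> 2 * measure lborel (ball (0::'a) (2 * R)) / R * e"
proof -
  let ?S = "{x \<in> ball 0 R. \<bar>a \<bullet> x\<bar> < e}"
  \<comment> \<open>The indices \<open>0..m\<close> give \<open>m + 1\<close> translates, at least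
    \<open>R / (2 * e)\<close> of them, while the largest shift \<open>2 * m * e\<close> is still at
    most \<open>R\<close>.\<close>
  define m where "m = nat \<lfloor>R / (2 * e)\<rfloor>"
  define T where "T k = (+) ((2 * real k * e) *\<^sub>R a) ` ?S" for k
  have aa: "a \<bullet> a = 1" using a by (simp add: norm_eq_1)
  have m: "real m \<le> R / (2 * e)" "R / (2 * e) \<le> real m + 1"
    using e R unfolding m_def by (auto simp: of_nat_nat)
  note S = slab_sets[of R a e]
  have fin: "emeasure lborel (ball (0::'a) (2 * R)) < \<infinity>"
    by (rule emeasure_lborel_ball_finite)
  \<comment> \<open>Pairing with \<open>a\<close> sends translate \<open>k\<close> into the open
    interval of radius \<open>e\<close> about \<open>2 * k * e\<close>; these intervals are
    disjoint.\<close>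
  have disj: "disjoint_family_on T {..m}"
    unfolding disjoint_family_on_def
  proof (intro ballI impI, rule equals0I)
    fix k k' y assume ne: "k \<noteq> k'" and "y \<in> T k \<inter> T k'"
    then have "y \<in> T k" "y \<in> T k'" by auto
    then obtain x x' where "y = (2 * real k * e) *\<^sub>R a + x" "y = (2 * real k' * e) *\<^sub>R a + x'"
      and x: "\<bar>a \<bullet> x\<bar> < e" "\<bar>a \<bullet> x'\<bar> < e" unfolding T_def by blast
    then have "a \<bullet> ((2 * real k * e) *\<^sub>R a + x) = a \<bullet> ((2 * real k' * e) *\<^sub>R a + x')" by simp
    then have "2 * e * (real k - real k') = a \<bullet> x' - a \<bullet> x"
      by (simp add: inner_add_right aa algebra_simps)
    then have "2 * e * \<bar>real k - real k'\<bar> = \<bar>a \<bullet> x' - a \<bullet> x\<bar>"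
      using e by (metis abs_mult abs_of_pos mult_pos_pos zero_less_numeral)
    also have "\<dots> < 2 * e" using x by linarith
    finally have "\<bar>real k - real k'\<bar> < 1" using e by simp
    with ne show False by linarith
  qed
  have sub: "(\<Union>k\<in>{..m}. T k) \<subseteq> ball 0 (2 * R)"
  proof (clarsimp simp: T_def)
    fix k and x :: 'a assume k: "k \<le> m" and x: "norm x < R"
    have "norm ((2 * real k * e) *\<^sub>R a + x) \<le> 2 * real k * e + norm x"
      using norm_triangle_ineq[of "(2 * real k * e) *\<^sub>R a" x] a e by simp
    also have "2 * real k * e \<le> R"
      using order_trans[OF _ m(1), of "real k"] k e by (simp add: field_simps)
    finally show "norm ((2 * real k * e) *\<^sub>R a + x) < 2 * R" using x by simp
  qed
  have T: "T k \<in> sets lborel" "emeasure lborel (T k) = emeasure lborel ?S" for k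
    unfolding T_def using lborel_emeasure_translate[OF S] by auto
  have S_fin: "emeasure lborel ?S < \<infinity>"
    by (rule le_less_trans[OF emeasure_mono fin]) (use R in auto)
  have "(real m + 1) * measure lborel ?S = (\<Sum>k\<le>m. measure lborel (T k))"
    by (simp add: measure_def T algebra_simps)
  also have "\<dots> = measure lborel (\<Union>k\<in>{..m}. T k)"
    using T S_fin disj by (intro measure_finite_Union[symmetric]) (auto simp: less_top)
  also have "\<dots> \<le> measure lborel (ball (0::'a) (2 * R))"
    using T fin sub by (intro measure_mono_fmeasurable) (auto simp: fmeasurable_def)
  finally have *: "(real m + 1) * measure lborel ?S \<le> measure lborel (ball (0::'a) (2 * R))" .
  have "R / (2 * e) * measure lborel ?S \<le> (real m + 1) * measure lborel ?S"
    using m by (intro mult_right_mono) auto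
  with * have "R / (2 * e) * measure lborel ?S \<le> measure lborel (ball (0::'a) (2 * R))" by simp
  then show ?thesis using e R by (simp add: field_simps)
qed

text \<open>Inside a fixed ball the slab volumes are bounded by a multiple of \<open>e l\<close>,
  hence summable, and Borel-Cantelli applies; countably many balls exhaust the space.\<close>

lemma AE_eventually_inner_ge:
  fixes a :: "nat \<Rightarrow> 'a::euclidean_space"
  assumes a: "\<And>l. norm (a l) = 1" and e: "\<And>l. 0 < e l" "summable e"
  shows "AE x in lborel. \<forall>\<^sub>F l in sequentially. e l \<le> \<bar>a l \<bullet> x\<bar>"
proof -
  let ?S = "\<lambda>R l. {x \<in> ball 0 R. \<bar>a l \<bullet> x\<bar> < e l}"
  have "AE x in lborel. \<forall>\<^sub>F l in sequentially. x \<in> space lborel - ?S R l" if R: "0 < R" for R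
  proof (rule borel_cantelli_AE1)
    fix l
    show "?S R l \<in> sets lborel" by (rule slab_sets)
    show "emeasure lborel (?S R l) < \<infinity>"
      by (rule le_less_trans[OF emeasure_mono emeasure_lborel_ball_finite[of 0 R]]) auto
  next
    show "summable (\<lambda>l. measure lborel (?S R l))"
    proof (rule summable_comparison_test)
      show "\<exists>N. \<forall>l\<ge>N. norm (measure lborel (?S R l))
          \<le> 2 * measure lborel (ball (0::'a) (2 * R)) / R * e l"
        using measure_slab_le[OF a e(1) R] by auto
    qed (intro summable_mult e)
  qed
  then have "AE x in lborel. \<forall>n. \<forall>\<^sub>F l in sequentially. x \<in> space lborel - ?S (real (Suc n)) l"
    by (subst AE_all_countable) auto
  then show ?thesis
  proof (rule AE_mp, intro AE_I2 impI)
    fix x :: 'a assume x: "\<forall>n. \<forall>\<^sub>F l in sequentially. x \<in> space lborel - ?S (real (Suc n)) l"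
    obtain n where "norm x < real n" using reals_Archimedean2 by blast
    then have "norm x < real (Suc n)" by simp
    then show "\<forall>\<^sub>F l in sequentially. e l \<le> \<bar>a l \<bullet> x\<bar>"
      using spec[OF x, of n] by (auto elim!: eventually_mono simp: not_less)
  qed
qed

subsection \<open>Numerical rank near a rank one matrix\<close>

lemma norm_vec_le_sum: "norm (x :: 'a::real_normed_vector^'n) \<le> (\<Sum>i\<in>UNIV. norm (x $ i))"
  unfolding norm_vec_def by (rule L2_set_le_sum) simp

lemma norm_matrix_vector_mult_le:
  fixes A :: "real^'m^'n"
  shows "norm (A *v x) \<le> norm A * norm x"
proof -
  have "norm (A *v x) \<le> L2_set (\<lambda>i. norm (A $ i) * norm x) UNIV"
    unfolding norm_vec_def[of "A *v x"]
    by (rule L2_set_mono) (simp_all add: matrix_vector_mul_component Cauchy_Schwarz_ineq2)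
  then show ?thesis by (simp add: L2_set_left_distrib[symmetric] norm_vec_def[of A])
qed

lemma norm_transpose:
  fixes A :: "real^'m^'n"
  shows "norm (transpose A) = norm A"
proof -
  have "(\<Sum>i\<in>UNIV. \<Sum>j\<in>UNIV. (A $ j $ i)\<^sup>2) = (\<Sum>j\<in>UNIV. \<Sum>i\<in>UNIV. (A $ j $ i)\<^sup>2)"
    by (rule sum.swap)
  then show ?thesis
    by (simp add: frobenius_norm_eq_norm[symmetric] frobenius_norm_def transpose_def)
qed

lemma norm_vector_matrix_mult_le:
  fixes A :: "real^'m^'n"
  shows "norm (x v* A) \<le> norm A * norm x"
  using norm_matrix_vector_mult_le[of "transpose A" x] by (simp add: norm_transpose)

lemma matrix_mult_row: "(A ** B) $ i = A $ i v* B"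
  for A :: "'a::comm_semiring_1^'m^'n"
  by (simp add: vec_eq_iff matrix_matrix_mult_def vector_matrix_mult_def mult.commute)

lemma norm_matrix_mult_le:
  fixes A :: "real^'m^'n" and B :: "real^'k^'m"
  shows "norm (A ** B) \<le> norm A * norm B"
proof -
  have "norm (A ** B) \<le> L2_set (\<lambda>i. norm (A $ i) * norm B) UNIV"
    unfolding norm_vec_def[of "A ** B"]
    by (rule L2_set_mono) (simp_all add: matrix_mult_row norm_vector_matrix_mult_le mult.commute)
  then show ?thesis by (simp add: L2_set_left_distrib[symmetric] norm_vec_def[of A])
qed

lemma bounded_bilinear_matrix_mult:
  "bounded_bilinear ((**) :: real^'m^'n \<Rightarrow> real^'k^'m \<Rightarrow> real^'k^'n)"
proof
  show "\<exists>K. \<forall>(A :: real^'m^'n) (B :: real^'k^'m). norm (A ** B) \<le> norm A * norm B * K"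
    using norm_matrix_mult_le by (intro exI[of _ 1]) auto
qed (simp_all add: vec_eq_iff matrix_matrix_mult_def sum.distrib algebra_simps sum_distrib_left)

lemma spectral_norm_le_norm: "spectral_norm X \<le> norm X"
  unfolding spectral_norm_def
  by (rule onorm_bound) (simp_all add: norm_matrix_vector_mult_le)

lemma norm_mult_le_spectral_norm: "norm (X *v y) \<le> spectral_norm X * norm y"
  unfolding spectral_norm_def by (rule onorm) simp

lemma spectral_norm_scaleR: "spectral_norm (c *\<^sub>R X) = \<bar>c\<bar> * spectral_norm X"
proof -
  have "(*v) (c *\<^sub>R X) = (\<lambda>y. c *\<^sub>R (X *v y))"
    by (simp add: fun_eq_iff scaleR_matrix_vector_assoc)
  then show ?thesis by (simp add: spectral_norm_def onorm_scaleR)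
qed

lemma num_rank_scaleR: "c \<noteq> 0 \<Longrightarrow> num_rank (c *\<^sub>R X) = num_rank X"
  by (simp add: num_rank_def frobenius_norm_eq_norm spectral_norm_scaleR power_mult_distrib)

section \<open>Outer products and their perturbations\<close>

definition outer :: "real^'n \<Rightarrow> real^'m \<Rightarrow> real^'m^'n" where
  "outer g h = (\<chi> i j. g $ i * h $ j)"

lemma norm_outer: "norm (outer g h) = norm g * norm h"
proof -
  have "norm (outer g h) = L2_set (\<lambda>i. norm (g $ i) * norm h) UNIV"
    unfolding norm_vec_def[of "outer g h"]
  proof (rule L2_set_cong[OF refl])
    fix i
    have "outer g h $ i = (g $ i) *\<^sub>R h" by (simp add: outer_def vec_eq_iff)
    then show "norm (outer g h $ i) = norm (g $ i) * norm h" by simp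
  qed
  then show ?thesis by (simp add: L2_set_left_distrib[symmetric] norm_vec_def[of g])
qed

lemma outer_matrix_mult: "outer g h ** X = outer g (h v* X)"
  by (simp add: outer_def vec_eq_iff matrix_matrix_mult_def vector_matrix_mult_def
      sum_distrib_left mult_ac)

lemma outer_vector_mult: "outer g h *v y = (h \<bullet> y) *\<^sub>R g"
  by (simp add: outer_def vec_eq_iff matrix_vector_mult_def inner_vec_def
      sum_distrib_left sum_distrib_right mult_ac)

text \<open>Rewrites a coordinate of \<open>g v* X v* P\<close> as the inner product of
  \<open>X\<close> with a fixed matrix, the form to which the slab estimate applies.\<close>

lemma inner_outer: "outer g h \<bullet> X = (g v* X) \<bullet> h"
  unfolding outer_def inner_vec_def vector_matrix_mult_def
  by (simp add: sum_distrib_right sum_distrib_left mult_ac) (rule sum.swap)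

text \<open>The triangle inequality bounds the Frobenius norm above by \<open>(1 + e) * c\<close>.
  Testing on \<open>y\<close>, where \<open>outer g y\<close> attains its norm, bounds the spectral
  norm below by \<open>(1 - e) * c\<close>.\<close>

lemma num_rank_near_rank_one:
  assumes g: "g \<noteq> 0" and y: "y \<noteq> 0" and e: "e < 1"
    and X: "norm (X - outer g y) \<le> e * (norm g * norm y)"
  shows "1 \<le> num_rank X" "num_rank X \<le> ((1 + e) / (1 - e))\<^sup>2"
proof -
  define c where "c = norm g * norm y"
  have "0 < c" using g y by (simp add: c_def)
  have up: "norm X \<le> (1 + e) * c"
    using norm_triangle_ineq[of "X - outer g y" "outer g y"] X
    by (simp add: norm_outer c_def algebra_simps)
  have "norm (outer g y *v y) \<le> norm (X *v y) + norm ((X - outer g y) *v y)"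
    using norm_triangle_ineq4[of "X *v y" "(X - outer g y) *v y"]
    by (simp add: matrix_vector_mult_diff_rdistrib)
  also have "norm (outer g y *v y) = c * norm y"
    by (simp add: outer_vector_mult c_def power2_norm_eq_inner[symmetric] power2_eq_square)
  also have "norm (X *v y) \<le> spectral_norm X * norm y" by (rule norm_mult_le_spectral_norm)
  also have "norm ((X - outer g y) *v y) \<le> e * c * norm y"
    using order_trans[OF norm_matrix_vector_mult_le mult_right_mono[OF X norm_ge_zero]]
    by (simp add: c_def)
  finally have "((1 - e) * c) * norm y \<le> spectral_norm X * norm y" by (simp add: algebra_simps)
  then have low: "(1 - e) * c \<le> spectral_norm X" using y by simp
  have pos: "0 < (1 - e) * c" using e \<open>0 < c\<close> by simp
  have s: "0 < spectral_norm X" using low pos by simp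
  have eq: "num_rank X = (norm X / spectral_norm X)\<^sup>2"
    by (simp add: num_rank_def frobenius_norm_eq_norm power_divide)
  show "1 \<le> num_rank X"
    unfolding eq using spectral_norm_le_norm[of X] s by (simp add: one_le_power)
  have "norm X / spectral_norm X \<le> ((1 + e) * c) / ((1 - e) * c)"
    using up low pos order_trans[OF norm_ge_zero up] by (intro frac_le) auto
  also have "\<dots> = (1 + e) / (1 - e)" using \<open>0 < c\<close> by simp
  finally show "num_rank X \<le> ((1 + e) / (1 - e))\<^sup>2"
    unfolding eq using s by (intro power_mono) auto
qed

lemma num_rank_tendsto_1:
  assumes g: "g \<noteq> 0" and y: "\<forall>\<^sub>F l in F. y l \<noteq> 0" and e: "(e \<longlongrightarrow> 0) F"
    and X: "\<forall>\<^sub>F l in F. norm (X l - outer g (y l)) \<le> e l * (norm g * norm (y l))"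
  shows "((\<lambda>l. num_rank (X l)) \<longlongrightarrow> 1) F"
proof (rule tendsto_sandwich[OF _ _ tendsto_const])
  have e1: "\<forall>\<^sub>F l in F. e l < 1" using e by (rule order_tendstoD) simp
  show "\<forall>\<^sub>F l in F. 1 \<le> num_rank (X l)" "\<forall>\<^sub>F l in F. num_rank (X l) \<le> ((1 + e l) / (1 - e l))\<^sup>2"
    using y e1 X by (eventually_elim, use num_rank_near_rank_one g in blast)+
  have "((\<lambda>l. ((1 + e l) / (1 - e l))\<^sup>2) \<longlongrightarrow> ((1 + 0) / (1 - 0))\<^sup>2) F"
    by (intro tendsto_intros e) simp
  then show "((\<lambda>l. ((1 + e l) / (1 - e l))\<^sup>2) \<longlongrightarrow> 1) F" by simp
qed

subsection \<open>Linear GCNs\<close>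

primrec weight_prod :: "(nat \<Rightarrow> real^'d^'d) \<Rightarrow> nat \<Rightarrow> real^'d^'d" where
  "weight_prod W 0 = mat 1"
| "weight_prod W (Suc l) = weight_prod W l ** W l"

lemma linear_gcn_eq: "linear_gcn A W X0 l = mat_power A l ** X0 ** weight_prod W l"
  by (induction l) (simp_all add: matrix_mul_assoc mat_power_commute[symmetric])

lemma invertible_weight_prod: "(\<And>k. invertible (W k)) \<Longrightarrow> invertible (weight_prod W l)"
  by (induction l) (auto intro: invertible_mult simp: invertible_def[of "mat 1"])

text \<open>Otherwise the column norms would sum to less than \<open>norm P\<close>. This allows a
  single coordinate of a product with \<open>P\<close> to stand for the size of
  \<open>P\<close>.\<close>

lemma exists_large_column:
  fixes P :: "real^'m^'n"
  shows "\<exists>j. norm P \<le> real CARD('m) * norm (column j P)"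
proof (rule ccontr)
  assume "\<not> ?thesis"
  then have *: "real CARD('m) * norm (column j P) < norm P" for j by (simp add: not_le)
  have "real CARD('m) * norm P \<le> real CARD('m) * (\<Sum>j\<in>UNIV. norm (column j P))"
    using norm_vec_le_sum[of "transpose P"]
    by (intro mult_left_mono) (simp_all add: norm_transpose, simp add: transpose_def column_def)
  also have "\<dots> = (\<Sum>j\<in>UNIV. real CARD('m) * norm (column j P))" by (simp add: sum_distrib_left)
  also have "\<dots> < (\<Sum>j\<in>(UNIV :: 'm set). norm P)" by (intro sum_strict_mono) (auto simp: *)
  finally show False by simp
qed

lemma AE_num_rank_linear_gcn:
  fixes A :: "real^'n^'n" and W :: "nat \<Rightarrow> real^'d^'d"
  assumes eig: "leading_eigenvalues A l1 l2" "l1 \<noteq> 0" "cmod (l2 / l1) < 1"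
    and W: "\<And>k. invertible (W k)"
  shows "AE X0 in lborel. (\<lambda>l. num_rank (linear_gcn A W X0 l)) \<longlonglongrightarrow> 1"
proof -
  obtain x r D :: real and g h :: "real^'n" where x: "x \<noteq> 0" and r: "0 < r" "r < 1"
    and g: "g \<noteq> 0" and h: "h \<noteq> 0"
    and close: "\<And>l i j. \<bar>mat_power A l $ i $ j / x ^ l - g $ i * h $ j\<bar> \<le> D * r ^ l"
    using dominant_eigenvalue_rank_one[OF eig] by metis
  let ?P = "weight_prod W"
  \<comment> \<open>Products of invertible weights are nonzero, so a large column of each can be
    normalised.\<close>
  have P: "?P l \<noteq> 0" for l
  proof
    assume "?P l = 0"
    then have "det (?P l) = 0" by (intro det_zero_row(1)) (simp add: row_def vec_eq_iff)
    moreover have "invertible (?P l)" by (intro invertible_weight_prod W)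
    ultimately show False by (simp add: invertible_det_nz)
  qed
  define c where "c = real CARD('d)"
  have "0 < c" by (simp add: c_def)
  have "\<forall>l. \<exists>j. norm (?P l) \<le> c * norm (column j (?P l))"
    unfolding c_def by (intro allI exists_large_column)
  then obtain j where j: "\<And>l. norm (?P l) \<le> c * norm (column (j l) (?P l))"
    by metis
  define p where "p l = column (j l) (?P l)" for l
  have p: "p l \<noteq> 0" "norm (?P l) \<le> c * norm (p l)" for l
    using j[of l] P[of l] by (auto simp: p_def)
  \<comment> \<open>The unit matrix direction for which \<open>a l \<bullet> X0\<close> is
    coordinate \<open>j l\<close> of \<open>h v* X0 v* ?P l\<close>, divided by
    \<open>norm h * norm (p l)\<close>.\<close>
  define a where "a l = outer h (p l) /\<^sub>R (norm h * norm (p l))" for l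
  have a: "norm (a l) = 1" for l
    using h p(1)[of l] by (simp add: a_def norm_outer field_simps)
  \<comment> \<open>Any value strictly between \<open>r\<close> and 1 serves:
    \<open>\<sigma> ^ l\<close> is summable, as Borel-Cantelli requires, yet decays more slowly than
    the error \<open>r ^ l\<close>.\<close>
  define \<sigma> where "\<sigma> = (1 + r) / 2"
  have \<sigma>: "0 < \<sigma>" "\<sigma> < 1" "r < \<sigma>" using r by (auto simp: \<sigma>_def)
  have "AE X0 in lborel. \<forall>\<^sub>F l in sequentially. \<sigma> ^ l \<le> \<bar>a l \<bullet> X0\<bar>"
    using \<sigma> by (intro AE_eventually_inner_ge a) auto
  then show ?thesis
  proof (rule AE_mp, intro AE_I2 impI)
    fix X0 assume ev: "\<forall>\<^sub>F l in sequentially. \<sigma> ^ l \<le> \<bar>a l \<bullet> X0\<bar>"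
    define y where "y l = (h v* X0) v* ?P l" for l
    define E where "E l = mat_power A l /\<^sub>R x ^ l - outer g h" for l
    have ylow: "\<forall>\<^sub>F l in sequentially. \<sigma> ^ l * norm h * norm (?P l) \<le> c * norm (y l)"
      using ev
    proof eventually_elim
      case (elim l)
      have "outer h (p l) \<bullet> X0 = y l $ j l"
        unfolding inner_outer
        by (simp add: y_def p_def vector_matrix_mult_def[of _ "?P l"] inner_vec_def column_def mult.commute)
      then have "a l \<bullet> X0 = y l $ j l / (norm h * norm (p l))"
        by (simp add: a_def divide_inverse mult_ac)
      then have "\<sigma> ^ l * (norm h * norm (p l)) \<le> \<bar>y l $ j l\<bar>"
        using elim h p(1)[of l] by (simp add: abs_divide pos_le_divide_eq)
      also have "\<dots> \<le> norm (y l)" by (rule component_le_norm_cart)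
      finally have "\<sigma> ^ l * (norm h * (c * norm (p l))) \<le> c * norm (y l)"
        using \<open>0 < c\<close> by (simp add: mult_ac)
      moreover have "\<sigma> ^ l * (norm h * norm (?P l)) \<le> \<sigma> ^ l * (norm h * (c * norm (p l)))"
        using \<sigma> p(2) by (intro mult_left_mono) auto
      ultimately show ?case by (simp add: mult_ac)
    qed
    define K where "K = real CARD('n) * real CARD('n) * D"
    have E: "norm (E l) \<le> K * r ^ l" for l
    proof -
      have "norm (E l) \<le> (\<Sum>i\<in>UNIV. \<Sum>j\<in>UNIV. norm (E l $ i $ j))"
        by (rule order_trans[OF norm_vec_le_sum sum_mono]) (rule norm_vec_le_sum)
      also have "\<dots> \<le> (\<Sum>i\<in>(UNIV::'n set). \<Sum>j\<in>(UNIV::'n set). D * r ^ l)"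
        using close by (intro sum_mono) (simp add: E_def outer_def divide_inverse mult.commute)
      finally show ?thesis by (simp add: K_def)
    qed
    have "0 \<le> K" using order_trans[OF norm_ge_zero E[of 0]] by simp
    \<comment> \<open>The error \<open>K * r ^ l * norm X0 * norm (?P l)\<close> relative to
      \<open>norm g * norm (y l)\<close>, after bounding \<open>norm (?P l)\<close> through
      \<open>ylow\<close>.\<close>
    define e where "e l = K * norm X0 * c / (norm h * norm g) * (r / \<sigma>) ^ l" for l
    have "(\<lambda>l. num_rank (linear_gcn A W X0 l /\<^sub>R x ^ l)) \<longlonglongrightarrow> 1"
    proof (rule num_rank_tendsto_1[OF g])
      show "\<forall>\<^sub>F l in sequentially. y l \<noteq> 0"
        using ylow
      proof eventually_elim
        case (elim l)
        moreover have "0 < \<sigma> ^ l * norm h * norm (?P l)" using \<sigma> h P by simp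
        ultimately show ?case by auto
      qed
      have "(\<lambda>l. (r / \<sigma>) ^ l) \<longlonglongrightarrow> 0"
        using r \<sigma> by (intro LIMSEQ_realpow_zero) auto
      then show "e \<longlonglongrightarrow> 0"
        unfolding e_def by (rule tendsto_mult_right_zero)
      show "\<forall>\<^sub>F l in sequentially. norm (linear_gcn A W X0 l /\<^sub>R x ^ l - outer g (y l))
          \<le> e l * (norm g * norm (y l))"
        using ylow
      proof eventually_elim
        case (elim l)
        have "linear_gcn A W X0 l /\<^sub>R x ^ l = (E l + outer g h) ** X0 ** ?P l"
          by (simp add: E_def linear_gcn_eq bounded_bilinear.scaleR_left[OF bounded_bilinear_matrix_mult])
        also have "\<dots> = E l ** X0 ** ?P l + outer g (y l)"
          by (simp add: bounded_bilinear.add_left[OF bounded_bilinear_matrix_mult] outer_matrix_mult y_def)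
        finally have "norm (linear_gcn A W X0 l /\<^sub>R x ^ l - outer g (y l)) = norm (E l ** X0 ** ?P l)"
          by simp
        also have "\<dots> \<le> norm (E l) * norm X0 * norm (?P l)"
          by (meson norm_matrix_mult_le order_trans mult_right_mono norm_ge_zero)
        also have "\<dots> \<le> K * r ^ l * norm X0 * norm (?P l)"
          using E by (intro mult_right_mono) auto
        also have "norm (?P l) \<le> c * norm (y l) / (\<sigma> ^ l * norm h)"
          using elim \<sigma> h by (simp add: pos_le_divide_eq mult_ac)
        then have "K * r ^ l * norm X0 * norm (?P l) \<le> K * r ^ l * norm X0 * (c * norm (y l) / (\<sigma> ^ l * norm h))"
          using \<open>0 \<le> K\<close> r by (intro mult_left_mono) auto
        also have "\<dots> = e l * (norm g * norm (y l))"
          using g by (simp add: e_def power_divide mult_ac)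
        finally show ?case .
      qed
    qed
    then show "(\<lambda>l. num_rank (linear_gcn A W X0 l)) \<longlonglongrightarrow> 1"
      using x by (simp add: num_rank_scaleR)
  qed
qed

section \<open>Measurability of the convergence event\<close>

lemma continuous_on_spectral_norm: "continuous_on UNIV (spectral_norm :: real^'m^'n \<Rightarrow> real)"
proof -
  have "spectral_norm X \<le> spectral_norm Y + norm (X - Y)" for X Y :: "real^'m^'n"
  proof -
    have "(*v) X = (\<lambda>z. Y *v z + (X - Y) *v z)"
      by (simp add: fun_eq_iff matrix_vector_mult_diff_rdistrib)
    then have "spectral_norm X \<le> spectral_norm Y + spectral_norm (X - Y)"
      unfolding spectral_norm_def by (simp add: onorm_triangle)
    then show ?thesis using spectral_norm_le_norm[of "X - Y"] by linarith
  qed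
  then have "\<bar>spectral_norm X - spectral_norm Y\<bar> \<le> norm (X - Y)" for X Y :: "real^'m^'n"
    by (smt (verit) norm_minus_commute)
  then have "1-lipschitz_on UNIV (spectral_norm :: real^'m^'n \<Rightarrow> real)"
    by (intro lipschitz_onI) (auto simp: dist_norm)
  then show ?thesis by (rule lipschitz_on_continuous_on)
qed

lemma borel_measurable_num_rank [measurable]: "num_rank \<in> borel_measurable borel"
proof -
  have [measurable]: "spectral_norm \<in> borel_measurable (borel :: (real^'m^'n) measure)" for m n
    by (intro borel_measurable_continuous_onI continuous_on_spectral_norm)
  show ?thesis unfolding num_rank_def[abs_def] frobenius_norm_eq_norm by measurable
qed

lemma borel_measurable_matrix_mult:
  fixes f :: "'a \<Rightarrow> real^'m^'n" and g :: "'a \<Rightarrow> real^'k^'m"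
  assumes "f \<in> borel_measurable M" "g \<in> borel_measurable M"
  shows "(\<lambda>x. f x ** g x) \<in> borel_measurable M"
  by (rule borel_measurable_continuous_Pair[OF assms])
    (intro bounded_bilinear.continuous_on[OF bounded_bilinear_matrix_mult] continuous_intros)

lemma borel_measurable_linear_gcn:
  assumes "\<And>k. W k \<in> borel_measurable M"
  shows "(\<lambda>x. linear_gcn A (\<lambda>k. W k (snd x)) (fst x) l) \<in> borel_measurable (lborel \<Otimes>\<^sub>M M)"
proof (induction l)
  case 0
  show ?case by simp
next
  case (Suc l)
  have "(\<lambda>x. W l (snd x)) \<in> borel_measurable (lborel \<Otimes>\<^sub>M M)"
    using assms by measurable
  then show ?case
    by (auto intro!: borel_measurable_matrix_mult Suc)
qed

text \<open>Tolerances \<open>1 / (k + 1)\<close> suffice, so convergence is expressed by countable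
  quantifiers only.\<close>

lemma measurable_tendsto_real:
  fixes f :: "nat \<Rightarrow> 'a \<Rightarrow> real"
  assumes [measurable]: "\<And>l. f l \<in> borel_measurable M"
  shows "{x \<in> space M. (\<lambda>l. f l x) \<longlonglongrightarrow> c} \<in> sets M"
proof -
  have "(\<lambda>l. f l x) \<longlonglongrightarrow> c \<longleftrightarrow> (\<forall>k. \<exists>N. \<forall>l\<ge>N. \<bar>f l x - c\<bar> < inverse (real (Suc k)))" for x
  proof
    assume "(\<lambda>l. f l x) \<longlonglongrightarrow> c"
    then show "\<forall>k. \<exists>N. \<forall>l\<ge>N. \<bar>f l x - c\<bar> < inverse (real (Suc k))"
      unfolding LIMSEQ_iff real_norm_def by (intro allI) (meson inverse_positive_iff_positive of_nat_0_less_iff zero_less_Suc)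
  next
    assume *: "\<forall>k. \<exists>N. \<forall>l\<ge>N. \<bar>f l x - c\<bar> < inverse (real (Suc k))"
    show "(\<lambda>l. f l x) \<longlonglongrightarrow> c"
      unfolding LIMSEQ_iff real_norm_def
      using * by (meson reals_Archimedean less_trans)
  qed
  then show ?thesis by simp
qed

theorem theorem5p1:
  fixes A :: "real^'n^'n"
    and l1 l2 :: complex
    and M :: "'w measure"
    and W :: "nat \<Rightarrow> 'w \<Rightarrow> real^'d^'d"
    and \<nu> :: "(real^'d^'d) measure"
    and matrix_norm :: "real^'d^'d \<Rightarrow> real"
  assumes eig: "leading_eigenvalues A l1 l2"
    and nonzero: "l1 \<noteq> 0"
    and gap: "cmod (l2 / l1) < 1"
    and prob: "prob_space M"
    and indep: "prob_space.indep_vars M (\<lambda>_. borel) W UNIV"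
    and ident: "\<And>l. distr M borel (W l) = \<nu>"
    and norm: "is_matrix_norm matrix_norm"
    and inv: "AE w in \<nu>. invertible w"
    and log_moments:
      "(\<integral>\<^sup>+ w. ennreal (log_plus (matrix_norm w)) \<partial>\<nu>)
        + (\<integral>\<^sup>+ w. ennreal (log_plus (matrix_norm (matrix_inv w))) \<partial>\<nu>) < \<infinity>"
  shows "AE X0 in (lborel :: (real^'d^'n) measure). AE \<omega> in M.
           (\<lambda>l. num_rank (linear_gcn A (\<lambda>k. W k \<omega>) X0 l)) \<longlonglongrightarrow> 1"
proof -
  interpret prob_space M by (rule prob)
  interpret pair_sigma_finite "lborel :: (real^'d^'n) measure" M ..
  have W: "W k \<in> borel_measurable M" for k
    using indep unfolding indep_vars_def by auto
  have "AE \<omega> in M. invertible (W k \<omega>)" for k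
  proof (rule AE_distrD[OF W])
    show "AE w in distr M borel (W k). invertible w" unfolding ident by (rule inv)
  qed
  \<comment> \<open>There are countably many weights, so one null set serves for all of
    them.\<close>
  then have "AE \<omega> in M. \<forall>k. invertible (W k \<omega>)"
    by (simp add: AE_all_countable)
  then have "AE \<omega> in M. AE X0 in (lborel :: (real^'d^'n) measure).
      (\<lambda>l. num_rank (linear_gcn A (\<lambda>k. W k \<omega>) X0 l)) \<longlonglongrightarrow> 1"
    by (rule AE_mp) (auto intro!: AE_I2 AE_num_rank_linear_gcn[OF eig nonzero gap])
  \<comment> \<open>Joint measurability of the convergence event lets Fubini swap the two
    almost-everywhere quantifiers.\<close>
  moreover have "{x \<in> space ((lborel :: (real^'d^'n) measure) \<Otimes>\<^sub>M M).
      (\<lambda>l. num_rank (linear_gcn A (\<lambda>k. W k (snd x)) (fst x) l)) \<longlonglongrightarrow> 1}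
      \<in> sets (lborel \<Otimes>\<^sub>M M)"
    by (intro measurable_tendsto_real measurable_compose[OF _ borel_measurable_num_rank]
        borel_measurable_linear_gcn W)
  ultimately show ?thesis by (subst AE_commute) auto
qed

end
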